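(* Let $\mathbb{X} \in \{\mathbb{N}, \mathbb{Z}\}$ and let $\mathcal{W}$ be the class of winning shifts $W(X)$ of all subshifts $X \subset S^{\mathbb{X}}$ over all finite alphabets $S$. Then $\mathcal{W}$ is exactly the class of downward closed subshifts of $\{A,B\}^{\mathbb{X}}$. The class $\mathcal{W}$ is closed under (binary) union and intersection.
   Context: $S$ is a nonempty finite set (alphabet), $S^*$ is the set of finite words over $S$ (including the empty word), and $0\in\mathbb{N}$. Games: let $n \in \mathbb{N}$ or $n=\mathbb{N}$, let $X \subset S^n$ and $a \in \{A,B\}^n$ (the turn order). Two players $A$ and $B$ build a word (infinite sequence if $n=\mathbb{N}$) $w \in S^n$ one letter at a time, starting from coordinate $0$; the letter $w_i$ is chosen by player $a_i$, knowing $w_0\cdots w_{i-1}$. Player $A$ wins if $w \in X$, otherwise $B$ wins. A strategy is a function assigning a letter of $S$ to each finite word of length less than $n$ (any finite word if $n=\mathbb{N}$); a strategy of $A$ is winning if the resulting word lies in $X$ whatever strategy $B$ uses. The winning set is $W(X) = \{a \in \{A,B\}^n : A \text{ has a winning strategy for the game with target set } X \text{ and turn order } a\}$. For a language $L \subset S^*$, $W(L) = \bigcup_{n\in\mathbb{N}} W(L\cap S^n)$. Subshifts: for $\mathbb{X}\in\{\mathbb{N},\mathbb{Z}\}$ and $F \subset S^*$, let $\mathcal{X}_F$ be the set of $x \in S^{\mathbb{X}}$ in which no word of $F$ appears as a contiguous factor; subshifts are exactly the sets of this form. $\mathcal{B}(X)$ denotes the set of all finite words appearing in points of $X$. Winning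 shifts: for a subshift $X\subset S^{\mathbb{N}}$, its winning shift is the winning set $W(X)\subset\{A,B\}^{\mathbb N}$, that is, the set of all $a\in\{A,B\}^{\mathbb N}$ such that $A$ has a winning strategy for the game with $n=\mathbb{N}$, target set $X$ and turn order $a$. For a subshift $X \subset S^{\mathbb{Z}}$, its winning shift is the two-directional subshift $W(X) = \mathcal{X}_F \subset \{A,B\}^{\mathbb{Z}}$, where $F = \{A,B\}^* \setminus W(\mathcal{B}(X))$. Order: $\{A,B\}$ is ordered by $A<B$, and $\{A,B\}^{\mathbb{X}}$ carries the coordinatewise partial order. A set $Y \subset \{A,B\}^{\mathbb{X}}$ is downward closed if $y\in Y$ and $z \le y$ imply $z \in Y$. *)

theory Defs
  imports Main "HOL-Library.Extended_Nat"
begin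

datatype player = PlayerA | PlayerB

instantiation player :: linorder
begin

definition less_eq_player :: "player \<Rightarrow> player \<Rightarrow> bool" where
  "p \<le> q \<longleftrightarrow> p = PlayerA \<or> q = PlayerB"

definition less_player :: "player \<Rightarrow> player \<Rightarrow> bool" where
  "p < q \<longleftrightarrow> p = PlayerA \<and> q = PlayerB"

instance
proof
  fix p q r :: player
  show "(p < q) = (p \<le> q \<and> \<not> q \<le> p)"
    by (cases p; cases q) (simp_all add: less_eq_player_def less_player_def)
  show "p \<le> p"
    by (cases p) (simp_all add: less_eq_player_def)
  show "p \<le> q \<Longrightarrow> q \<le> r \<Longrightarrow> p \<le> r"
    by (auto simp: less_eq_player_def)
  show "p \<le> q \<Longrightarrow> q \<le> p \<Longrightarrow> p = q"
    by (auto simp: less_eq_player_def)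
  show "p \<le> q \<or> q \<le> p"
    by (cases p; cases q) (simp_all add: less_eq_player_def)
qed

end

section \<open>Subshifts\<close>

text \<open>
  Alphabets are finite nonempty sets \<open>S\<close> of letters, words over \<open>S\<close> are elements of \<open>lists S\<close>.
  The index type \<open>'i\<close> of configurations is instantiated with \<open>nat\<close> (one-sided) and \<open>int\<close>
  (two-sided).
\<close>

definition occurs_in :: "'s list \<Rightarrow> ('i::semiring_1 \<Rightarrow> 's) \<Rightarrow> bool" where
  "occurs_in w x \<longleftrightarrow> (\<exists>i. \<forall>k < length w. x (i + of_nat k) = w ! k)"

definition avoiding :: "'s set \<Rightarrow> 's list set \<Rightarrow> ('i::semiring_1 \<Rightarrow> 's) set" where
  "avoiding S F = {x. range x \<subseteq> S \<and> (\<forall>w\<in>F. \<not> occurs_in w x)}"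

definition subshift :: "'s set \<Rightarrow> ('i::semiring_1 \<Rightarrow> 's) set \<Rightarrow> bool" where
  "subshift S X \<longleftrightarrow> (\<exists>F. F \<subseteq> lists S \<and> X = avoiding S F)"

definition language :: "('i::semiring_1 \<Rightarrow> 's) set \<Rightarrow> 's list set" where
  "language X = {w. \<exists>x\<in>X. occurs_in w x}"

section \<open>Games\<close>

text \<open>Strategies for games of length \<open>n\<close>; the length \<open>\<infinity>\<close> stands for games indexed by all of
  the natural numbers. The values outside of words over \<open>S\<close> of length less than \<open>n\<close>
  are never used in a play.\<close>

definition strategies :: "'s set \<Rightarrow> enat \<Rightarrow> ('s list \<Rightarrow> 's) set" where
  "strategies S n = {\<sigma>. \<forall>w\<in>lists S. enat (length w) < n \<longrightarrow> \<sigma> w \<in> S}"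

primrec play_prefix ::
    "('s list \<Rightarrow> 's) \<Rightarrow> ('s list \<Rightarrow> 's) \<Rightarrow> (nat \<Rightarrow> player) \<Rightarrow> nat \<Rightarrow> 's list" where
  "play_prefix \<sigma> \<tau> a 0 = []"
| "play_prefix \<sigma> \<tau> a (Suc k) =
     (let w = play_prefix \<sigma> \<tau> a k
      in w @ [case a k of PlayerA \<Rightarrow> \<sigma> w | PlayerB \<Rightarrow> \<tau> w])"

definition finite_play ::
    "('s list \<Rightarrow> 's) \<Rightarrow> ('s list \<Rightarrow> 's) \<Rightarrow> player list \<Rightarrow> 's list" where
  "finite_play \<sigma> \<tau> a = play_prefix \<sigma> \<tau> (\<lambda>k. a ! k) (length a)"

definition infinite_play ::
    "('s list \<Rightarrow> 's) \<Rightarrow> ('s list \<Rightarrow> 's) \<Rightarrow> (nat \<Rightarrow> player) \<Rightarrow> nat \<Rightarrow> 's" where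
  "infinite_play \<sigma> \<tau> a k = play_prefix \<sigma> \<tau> a (Suc k) ! k"

definition finite_winning_set :: "'s set \<Rightarrow> nat \<Rightarrow> 's list set \<Rightarrow> player list set" where
  "finite_winning_set S n X =
     {a. length a = n \<and>
         (\<exists>\<sigma>\<in>strategies S (enat n). \<forall>\<tau>\<in>strategies S (enat n). finite_play \<sigma> \<tau> a \<in> X)}"

definition infinite_winning_set :: "'s set \<Rightarrow> (nat \<Rightarrow> 's) set \<Rightarrow> (nat \<Rightarrow> player) set" where
  "infinite_winning_set S X =
     {a. \<exists>\<sigma>\<in>strategies S \<infinity>. \<forall>\<tau>\<in>strategies S \<infinity>. infinite_play \<sigma> \<tau> a \<in> X}"

definition winning_language :: "'s set \<Rightarrow> 's list set \<Rightarrow> player list set" where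
  "winning_language S L =
     (\<Union>n. finite_winning_set S n (L \<inter> {w \<in> lists S. length w = n}))"

section \<open>Winning shifts\<close>

definition winning_shift_nat :: "'s set \<Rightarrow> (nat \<Rightarrow> 's) set \<Rightarrow> (nat \<Rightarrow> player) set" where
  "winning_shift_nat S X = infinite_winning_set S X"

definition winning_shift_int :: "'s set \<Rightarrow> (int \<Rightarrow> 's) set \<Rightarrow> (int \<Rightarrow> player) set" where
  "winning_shift_int S X = avoiding UNIV (UNIV - winning_language S (language X))"

text \<open>
  The classes of winning shifts over all finite alphabets whose letters are taken from the
  type \<open>'s\<close>. If \<open>'s\<close> is infinite, then it contains a copy of every finite alphabet; renaming the
  letters does not affect the winning shift.
\<close>

definition winning_shifts_nat :: "'s itself \<Rightarrow> (nat \<Rightarrow> player) set set" where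
  "winning_shifts_nat _ =
     {winning_shift_nat S X | (S :: 's set) X. finite S \<and> S \<noteq> {} \<and> subshift S X}"

definition winning_shifts_int :: "'s itself \<Rightarrow> (int \<Rightarrow> player) set set" where
  "winning_shifts_int _ =
     {winning_shift_int S X | (S :: 's set) X. finite S \<and> S \<noteq> {} \<and> subshift S X}"

definition downward_closed :: "('i \<Rightarrow> player) set \<Rightarrow> bool" where
  "downward_closed Y \<longleftrightarrow> (\<forall>y\<in>Y. \<forall>z. z \<le> y \<longrightarrow> z \<in> Y)"

end

theory Submission
  imports Defs "HOL-Library.Sublist"
begin

text \<open>
  By backward induction over finite games, and compactness for infinite ones, in both cases
  \<open>W(X)\<close> consists of the sequences all of whose factors lie in \<open>W(\<B>(X))\<close>. It is therefore a
  subshift, and it is downward closed because giving turns to \<open>A\<close> only helps \<open>A\<close>. Conversely, a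
  downward closed subshift \<open>Y\<close>, read as a subshift over the two letters \<open>A < B\<close>, is its own winning
  shift: for a turn order in \<open>Y\<close>, player \<open>A\<close> wins by always playing the letter \<open>A\<close>, and if \<open>B\<close>
  always plays the letter \<open>B\<close>, then the resulting word is above the turn order.
\<close>

section \<open>Subshifts and their languages\<close>

definition factor_at :: "('i::semiring_1 \<Rightarrow> 's) \<Rightarrow> 'i \<Rightarrow> nat \<Rightarrow> 's list" where
  "factor_at x i n = map (\<lambda>k. x (i + of_nat k)) [0..<n]"

lemma length_factor_at [simp]: "length (factor_at x i n) = n"
  by (simp add: factor_at_def)

lemma occurs_in_iff_factor_at: "occurs_in w x \<longleftrightarrow> (\<exists>i. factor_at x i (length w) = w)"
proof -
  have "factor_at x i (length w) = w \<longleftrightarrow> (\<forall>k < length w. x (i + of_nat k) = w ! k)" for i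
    by (subst list_eq_iff_nth_eq) (simp add: factor_at_def)
  then show ?thesis
    by (simp only: occurs_in_def)
qed

lemma occurs_in_factor_at [simp]: "occurs_in (factor_at x i n) x"
  unfolding occurs_in_iff_factor_at by auto

lemma factor_at_add:
  "factor_at x i (m + n) = factor_at x i m @ factor_at x (i + of_nat m) n"
  by (induction n) (simp_all add: factor_at_def add.assoc)

lemma sublist_factor_at:
  assumes "d + m \<le> n"
  shows "sublist (factor_at x (i + of_nat d) m) (factor_at x i n)"
proof -
  obtain e where "n = d + (m + e)"
    using assms by (metis add.assoc le_Suc_ex)
  then show ?thesis
    by (simp add: factor_at_add)
qed

lemma occurs_in_sublist:
  assumes "occurs_in w x" "sublist f w"
  shows "occurs_in f x"
proof -
  obtain u v where w: "w = u @ f @ v"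
    using assms(2) by (auto simp: sublist_def)
  obtain i where i: "\<And>k. k < length w \<Longrightarrow> x (i + of_nat k) = w ! k"
    using assms(1) by (auto simp: occurs_in_def)
  have "x (i + of_nat (length u) + of_nat k) = f ! k" if "k < length f" for k
    using i[of "length u + k"] that by (simp add: w nth_append add.assoc)
  then show ?thesis
    unfolding occurs_in_def by blast
qed

lemma factor_at_in_language: "x \<in> X \<Longrightarrow> factor_at x i n \<in> language X"
  unfolding language_def using occurs_in_factor_at by blast

lemma language_sublist: "w \<in> language X \<Longrightarrow> sublist f w \<Longrightarrow> f \<in> language X"
  by (auto simp: language_def intro: occurs_in_sublist)

lemma subshift_avoiding: "F \<subseteq> lists S \<Longrightarrow> subshift S (avoiding S F)"
  by (auto simp: subshift_def)

text \<open>A forbidden word occurring in \<open>x\<close> would lie in \<open>language X\<close>,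
  hence occur in a point of \<open>X\<close>, which avoids it.\<close>

lemma subshift_memI:
  assumes "subshift S X" "range x \<subseteq> S" "\<And>w. occurs_in w x \<Longrightarrow> w \<in> language X"
  shows "x \<in> X"
  using assms unfolding subshift_def avoiding_def language_def by blast

text \<open>The complement of the language is the largest choice of forbidden words. This recovers
  \<open>Y\<close> once a winning language has been identified with
  \<open>language Y\<close>.\<close>

lemma avoiding_Compl_language:
  assumes "subshift UNIV Y"
  shows "avoiding UNIV (UNIV - language Y) = Y"
proof
  show "avoiding UNIV (UNIV - language Y) \<subseteq> Y"
    by (rule subsetI, rule subshift_memI[OF assms]) (auto simp: avoiding_def)
  show "Y \<subseteq> avoiding UNIV (UNIV - language Y)"
    by (auto simp: avoiding_def language_def)
qed

section \<open>Intersections and unions of subshifts\<close>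

lemma subshift_Int:
  assumes "subshift S Y" "subshift S Z"
  shows "subshift S (Y \<inter> Z)"
proof -
  obtain F G where F: "F \<subseteq> lists S" "Y = avoiding S F" and G: "G \<subseteq> lists S" "Z = avoiding S G"
    using assms by (auto simp: subshift_def)
  then have "Y \<inter> Z = avoiding S (F \<union> G)"
    by (auto simp: avoiding_def)
  with F(1) G(1) show ?thesis
    by (metis Un_least subshift_avoiding)
qed

text \<open>A window opening at the earlier of the two positions can be made long enough to cover
  both occurrences. \<open>comparable\<close> holds for natural numbers and for integers, so one
  proof serves both.\<close>

lemma ex_factor_containing:
  assumes "occurs_in f x" "occurs_in g x"
    and comparable: "\<And>i j :: 'i::semiring_1. (\<exists>d. j = i + of_nat d) \<or> (\<exists>d. i = j + of_nat d)"
  shows "\<exists>w. occurs_in w (x :: 'i \<Rightarrow> 's) \<and> sublist f w \<and> sublist g w"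
proof -
  have *: "\<exists>w. occurs_in w x \<and> sublist f w \<and> sublist g w"
    if "factor_at x i (length f) = f" "factor_at x (i + of_nat d) (length g) = g" for f g i d
  proof -
    define n where "n = length f + (d + length g)"
    have "sublist f (factor_at x i n)"
      using sublist_factor_at[of 0 "length f" n x i] that(1) by (simp add: n_def)
    moreover have "sublist g (factor_at x i n)"
      using sublist_factor_at[of d "length g" n x i] that(2) by (simp add: n_def)
    ultimately show ?thesis
      using occurs_in_factor_at by blast
  qed
  obtain i j where "factor_at x i (length f) = f" "factor_at x j (length g) = g"
    using assms(1,2) unfolding occurs_in_iff_factor_at by blast
  then show ?thesis
    using comparable[of j i] *[where f = f and i = i and g = g] *[where f = g and i = j and g = f]
    by blast
qed

text \<open>Forbid the words that contain both a word of \<open>F\<close> and a word of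
  \<open>G\<close>: a point in neither \<open>Y\<close> nor \<open>Z\<close> contains one of each,
  and a window covering both is then forbidden.\<close>

lemma subshift_Un:
  assumes "subshift S Y" "subshift S Z"
    and comparable: "\<And>i j :: 'i::semiring_1. (\<exists>d. j = i + of_nat d) \<or> (\<exists>d. i = j + of_nat d)"
  shows "subshift S (Y \<union> Z :: ('i \<Rightarrow> 's) set)"
proof -
  obtain F G where F: "Y = avoiding S F" and G: "Z = avoiding S G"
    using assms by (auto simp: subshift_def)
  define H where "H = {w \<in> lists S. (\<exists>f\<in>F. sublist f w) \<and> (\<exists>g\<in>G. sublist g w)}"
  have "Y \<union> Z \<subseteq> avoiding S H"
    unfolding F G H_def avoiding_def using occurs_in_sublist by blast
  moreover have "x \<in> Y \<union> Z" if x: "x \<in> avoiding S H" for x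
  proof (rule ccontr)
    assume "x \<notin> Y \<union> Z"
    then obtain f g where fg: "f \<in> F" "occurs_in f x" "g \<in> G" "occurs_in g x"
      using x by (auto simp: F G avoiding_def)
    then obtain w where w: "occurs_in w x" "sublist f w" "sublist g w"
      using ex_factor_containing[OF _ _ comparable] by blast
    from w(1) obtain i where "factor_at x i (length w) = w"
      unfolding occurs_in_iff_factor_at by blast
    \<comment> \<open>\<open>H\<close> consists of words over \<open>S\<close> only, so the window
      must be seen to use letters of \<open>S\<close>.\<close>
    moreover have "factor_at x i (length w) \<in> lists S"
      using x by (auto simp: avoiding_def factor_at_def image_subset_iff)
    ultimately have "w \<in> H"
      using fg w unfolding H_def by auto
    with x w(1) show False
      by (auto simp: avoiding_def)
  qed
  ultimately have "Y \<union> Z = avoiding S H"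
    by blast
  moreover have "H \<subseteq> lists S"
    by (auto simp: H_def)
  ultimately show ?thesis
    by (simp add: subshift_avoiding)
qed

section \<open>Backward induction\<close>

text \<open>Value of a position by backward induction: \<open>w\<close> is the word played so far,
  the list holds the turns still to come, and \<open>L\<close> is the target for the completed
  word.\<close>

primrec wins :: "'s set \<Rightarrow> 's list set \<Rightarrow> player list \<Rightarrow> 's list \<Rightarrow> bool" where
  "wins S L [] w \<longleftrightarrow> w \<in> L"
| "wins S L (p # a) w \<longleftrightarrow>
     (case p of PlayerA \<Rightarrow> \<exists>s\<in>S. wins S L a (w @ [s]) | PlayerB \<Rightarrow> \<forall>s\<in>S. wins S L a (w @ [s]))"

section \<open>From strategies to backward induction and back\<close>

lemma length_play_prefix [simp]: "length (play_prefix \<sigma> \<tau> a k) = k"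
  by (induction k) (simp_all add: Let_def)

lemma play_prefix_in_lists:
  assumes "\<sigma> \<in> strategies S N" "\<tau> \<in> strategies S N" "enat k \<le> N"
  shows "play_prefix \<sigma> \<tau> a k \<in> lists S"
  using assms(3)
proof (induction k)
  case (Suc k)
  have k: "enat k < N"
    using Suc.prems Suc_ile_eq by blast
  then have "play_prefix \<sigma> \<tau> a k \<in> lists S"
    using Suc.IH by auto
  with k assms show ?case
    by (auto simp: strategies_def Let_def split: player.split)
qed auto

text \<open>Lets \<open>B\<close> change the reply at length \<open>k\<close> without disturbing the
  position reached there.\<close>

lemma play_prefix_cong:
  assumes "\<And>w. length w < k \<Longrightarrow> \<tau> w = \<tau>' w"
  shows "play_prefix \<sigma> \<tau> a k = play_prefix \<sigma> \<tau>' a k"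
  using assms by (induction k) (simp_all add: Let_def cong: player.case_cong)

text \<open>\<open>N\<close> is the length of the game and \<open>n\<close> a horizon inside it, so
  this serves finite games with \<open>N = enat n\<close> as well as infinite ones with
  \<open>N = \<infinity>\<close>.\<close>

lemma strategy_imp_wins:
  assumes \<sigma>: "\<sigma> \<in> strategies S N" and "S \<noteq> {}" and n: "enat n \<le> N"
    and win: "\<And>\<tau>. \<tau> \<in> strategies S N \<Longrightarrow> play_prefix \<sigma> \<tau> a n \<in> L"
  shows "wins S L (map a [0..<n]) []"
proof -
  \<comment> \<open>Descending induction on \<open>k\<close>: every position reached while
    \<open>A\<close> follows \<open>\<sigma>\<close> is won. \<open>\<tau>\<close> stays arbitrary
    because altered replies of \<open>B\<close> are needed.\<close>
  have *: "wins S L (map a [k..<n]) (play_prefix \<sigma> \<tau> a k)"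
    if "k \<le> n" "\<tau> \<in> strategies S N" for k \<tau>
    using that
  proof (induction arbitrary: \<tau> rule: inc_induct)
    case base
    then show ?case
      by (simp add: win)
  next
    case (step k)
    let ?w = "play_prefix \<sigma> \<tau> a k"
    have kN: "enat k < N"
      using step.hyps n by (meson enat_ord_simps(2) less_le_trans)
    have w: "?w \<in> lists S"
      using play_prefix_in_lists \<sigma> step.prems kN by (meson less_imp_le)
    show ?case
    proof (cases "a k")
      case PlayerA
      have "\<sigma> ?w \<in> S"
        using \<sigma> w kN by (simp add: strategies_def)
      with PlayerA step.IH[OF step.prems] step.hyps show ?thesis
        by (auto simp: upt_conv_Cons Let_def)
    next
      case PlayerB
      have "wins S L (map a [Suc k..<n]) (?w @ [s])" if "s \<in> S" for s
      proof -
        \<comment> \<open>\<open>B\<close> deviates only at words of length \<open>k\<close>, so the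
          same position is reached and then continued by \<open>s\<close>.\<close>
        define \<tau>' where "\<tau>' = (\<lambda>v. if length v = k then s else \<tau> v)"
        have "\<tau>' \<in> strategies S N"
          using step.prems that by (simp add: strategies_def \<tau>'_def)
        moreover have "play_prefix \<sigma> \<tau>' a k = ?w"
          by (rule play_prefix_cong) (simp add: \<tau>'_def)
        ultimately show ?thesis
          using step.IH[of \<tau>'] PlayerB by (simp add: Let_def \<tau>'_def)
      qed
      with PlayerB step.hyps show ?thesis
        by (simp add: upt_conv_Cons)
    qed
  qed
  obtain s where "s \<in> S"
    using assms(2) by blast
  then have "(\<lambda>_. s) \<in> strategies S N"
    by (simp add: strategies_def)
  from *[OF _ this, of 0] show ?thesis
    by simp
qed

text \<open>\<open>A\<close> moves into \<open>G\<close> whenever some letter allows it; by the step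
  hypothesis \<open>G\<close> then survives every move of either player.\<close>

lemma strategy_from_invariant:
  assumes "S \<noteq> {}" "G []"
    and step: "\<And>w. w \<in> lists S \<Longrightarrow> enat (length w) < N \<Longrightarrow> G w \<Longrightarrow>
      (case a (length w) of PlayerA \<Rightarrow> \<exists>s\<in>S. G (w @ [s]) | PlayerB \<Rightarrow> \<forall>s\<in>S. G (w @ [s]))"
  shows "\<exists>\<sigma>\<in>strategies S N. \<forall>\<tau>\<in>strategies S N. \<forall>k. enat k \<le> N \<longrightarrow> G (play_prefix \<sigma> \<tau> a k)"
proof -
  \<comment> \<open>Where no letter leads into \<open>G\<close>, any letter is taken, so that
    \<open>\<sigma>\<close> has values in \<open>S\<close> on every word.\<close>
  have "\<exists>s\<in>S. (\<exists>s\<in>S. G (w @ [s])) \<longrightarrow> G (w @ [s])" for w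
    using assms(1) by blast
  then obtain \<sigma> where \<sigma>: "\<And>w. \<sigma> w \<in> S" "\<And>w. (\<exists>s\<in>S. G (w @ [s])) \<Longrightarrow> G (w @ [\<sigma> w])"
    by metis
  then have strat: "\<sigma> \<in> strategies S N"
    by (simp add: strategies_def)
  have "G (play_prefix \<sigma> \<tau> a k)" if \<tau>: "\<tau> \<in> strategies S N" and "enat k \<le> N" for \<tau> k
    using that(2)
  proof (induction k)
    case 0
    then show ?case
      by (simp add: assms)
  next
    case (Suc k)
    let ?w = "play_prefix \<sigma> \<tau> a k"
    have k: "enat k < N"
      using Suc.prems Suc_ile_eq by blast
    then have "?w \<in> lists S"
      using play_prefix_in_lists[OF strat \<tau>] by auto
    moreover from this have "\<tau> ?w \<in> S"
      using \<tau> k by (simp add: strategies_def)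
    ultimately show ?case
      using step[of ?w] Suc.IH k \<sigma>(2)[of ?w]
      by (cases "a k") (simp_all add: Let_def)
  qed
  with strat show ?thesis
    by blast
qed

lemma winning_language_iff:
  assumes "S \<noteq> {}"
  shows "a \<in> winning_language S L \<longleftrightarrow> wins S L a []"
proof
  assume "a \<in> winning_language S L"
  then obtain \<sigma> where "\<sigma> \<in> strategies S (enat (length a))"
    "\<And>\<tau>. \<tau> \<in> strategies S (enat (length a)) \<Longrightarrow> play_prefix \<sigma> \<tau> (nth a) (length a) \<in> L"
    by (auto simp: winning_language_def finite_winning_set_def finite_play_def)
  then have "wins S L (map (nth a) [0..<length a]) []"
    using strategy_imp_wins assms by blast
  then show "wins S L a []"
    by (simp add: map_nth)
next
  let ?N = "enat (length a)"
  assume "wins S L a []"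
  \<comment> \<open>Invariant: the turns left after \<open>w\<close> are won from \<open>w\<close>.
    At the end of the play no turns are left, and it reads as membership in
    \<open>L\<close>.\<close>
  then have "\<exists>\<sigma>\<in>strategies S ?N. \<forall>\<tau>\<in>strategies S ?N. \<forall>k. enat k \<le> ?N \<longrightarrow>
      (\<lambda>w. wins S L (drop (length w) a) w) (play_prefix \<sigma> \<tau> (nth a) k)"
    by (intro strategy_from_invariant[OF assms]) (simp_all cong: player.case_cong flip: Cons_nth_drop_Suc)
  then obtain \<sigma> where \<sigma>: "\<sigma> \<in> strategies S ?N"
    and win: "\<And>\<tau> k. \<tau> \<in> strategies S ?N \<Longrightarrow> k \<le> length a \<Longrightarrow>
      wins S L (drop k a) (play_prefix \<sigma> \<tau> (nth a) k)"
    by auto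
  have "finite_play \<sigma> \<tau> a \<in> L \<inter> {w \<in> lists S. length w = length a}" if "\<tau> \<in> strategies S ?N" for \<tau>
    using win[OF that, of "length a"] play_prefix_in_lists[OF \<sigma> that]
    by (simp add: finite_play_def)
  with \<sigma> show "a \<in> winning_language S L"
    unfolding winning_language_def finite_winning_set_def by blast
qed

section \<open>Monotonicity of winning and passage to prefixes and suffixes\<close>

lemma wins_mono:
  assumes "S \<noteq> {}" "list_all2 (\<le>) b a" "wins S L a w"
  shows "wins S L b w"
  using assms(2,3)
proof (induction arbitrary: w rule: list_all2_induct)
  case (Cons q b p a)
  then show ?case
    using assms(1) by (cases p; cases q) (auto simp: less_eq_player_def)
qed simp

text \<open>After \<open>a\<close>, the turns of \<open>b\<close> can be played on to a word of
  \<open>L\<close>, since \<open>S\<close> is nonempty; the word present at the end of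
  \<open>a\<close> is a prefix of it.\<close>

lemma wins_prefix:
  assumes "S \<noteq> {}" "\<And>u v. u @ v \<in> L \<Longrightarrow> u \<in> L" "wins S L (a @ b) w"
  shows "wins S L a w"
  using assms(3)
proof (induction a arbitrary: w)
  case Nil
  then show ?case
  proof (induction b arbitrary: w)
    case (Cons p b)
    then obtain s where "wins S L b (w @ [s])"
      using assms(1) by (auto split: player.splits)
    then have "w @ [s] \<in> L"
      using Cons.IH[of "w @ [s]"] by simp
    then show ?case
      using assms(2) by simp
  qed simp
next
  case (Cons p a)
  then show ?case
    by (cases p) auto
qed

text \<open>The same moves succeed without \<open>u\<close> in front: the completed word merely
  loses that prefix.\<close>

lemma wins_strip_prefix:
  assumes "\<And>u v. u @ v \<in> L \<Longrightarrow> v \<in> L" "wins S L a (u @ v)"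
  shows "wins S L a v"
  using assms(2)
proof (induction a arbitrary: v)
  case (Cons p a)
  then show ?case
    by (cases p) auto
qed (use assms(1) in auto)

text \<open>Some play of the turns in \<open>b\<close> leads to a position from which
  \<open>a\<close> is won; its letters can then be forgotten.\<close>

lemma wins_suffix:
  assumes "S \<noteq> {}" "\<And>u v. u @ v \<in> L \<Longrightarrow> v \<in> L" "wins S L (b @ a) []"
  shows "wins S L a []"
  using assms(3)
proof (induction b)
  case (Cons p b)
  then obtain s where "wins S L (b @ a) ([s] @ [])"
    using assms(1) by (auto split: player.splits)
  then have "wins S L (b @ a) []"
    using wins_strip_prefix[of L S "b @ a" "[s]" "[]"] assms(2) by blast
  then show ?case
    by (rule Cons.IH)
qed simp

section \<open>Winning shifts\<close>

lemma infinite_play_prefix: "map (infinite_play \<sigma> \<tau> a) [0..<n] = play_prefix \<sigma> \<tau> a n"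
proof (induction n)
  case (Suc n)
  have "infinite_play \<sigma> \<tau> a n = last (play_prefix \<sigma> \<tau> a (Suc n))"
    by (simp add: infinite_play_def Let_def nth_append)
  with Suc show ?case
    by (simp add: Let_def)
qed simp

text \<open>For the converse, \<open>A\<close> maintains that every finite horizon is won from the
  current word. All prefixes of the play are then in the language, so the play belongs to the
  subshift.\<close>

lemma infinite_winning_set_iff:
  assumes "finite S" "S \<noteq> {}" "subshift S X"
  shows "a \<in> infinite_winning_set S X \<longleftrightarrow> (\<forall>n. wins S (language X) (map a [0..<n]) [])"
proof
  assume "a \<in> infinite_winning_set S X"
  then obtain \<sigma> where \<sigma>: "\<sigma> \<in> strategies S \<infinity>"
    "\<And>\<tau>. \<tau> \<in> strategies S \<infinity> \<Longrightarrow> infinite_play \<sigma> \<tau> a \<in> X"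
    by (auto simp: infinite_winning_set_def)
  have "play_prefix \<sigma> \<tau> a n \<in> language X" if "\<tau> \<in> strategies S \<infinity>" for \<tau> n
  proof -
    have "play_prefix \<sigma> \<tau> a n = factor_at (infinite_play \<sigma> \<tau> a) 0 n"
      by (simp add: factor_at_def flip: infinite_play_prefix)
    then show ?thesis
      using \<sigma>(2)[OF that] by (simp add: factor_at_in_language)
  qed
  then show "\<forall>n. wins S (language X) (map a [0..<n]) []"
    using strategy_imp_wins[OF \<sigma>(1) assms(2)] by simp
next
  let ?L = "language X"
  define G where "G w \<longleftrightarrow> (\<forall>n. wins S ?L (map a [length w..<length w + n]) w)" for w
  assume "\<forall>n. wins S ?L (map a [0..<n]) []"
  then have "G []"
    by (simp add: G_def)
  have step: "case a (length w) of PlayerA \<Rightarrow> \<exists>s\<in>S. G (w @ [s]) | PlayerB \<Rightarrow> \<forall>s\<in>S. G (w @ [s])"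
    if "G w" for w
  proof -
    let ?turns = "\<lambda>n. map a [Suc (length w)..<Suc (length w) + n]"
    have turns: "map a [length w..<length w + Suc n] = a (length w) # ?turns n" for n
      by (simp add: upt_conv_Cons del: upt_Suc)
    have next_turn: "wins S ?L (a (length w) # ?turns n) w" for n
      using that unfolding G_def turns[symmetric] by blast
    \<comment> \<open>Winning up to a horizon includes winning up to any smaller one, as the
      language is closed under factors.\<close>
    have decreasing: "wins S ?L (?turns m) v" if "wins S ?L (?turns n) v" "m \<le> n" for m n v
    proof (rule wins_prefix[OF assms(2)])
      obtain k where "n = m + k"
        using \<open>m \<le> n\<close> le_Suc_ex by blast
      then have "?turns n = ?turns m @ map a [Suc (length w) + m..<Suc (length w) + n]"
        using upt_add_eq_append[of "Suc (length w)" "Suc (length w) + m" k]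
        by (simp add: add.assoc del: upt_Suc)
      with that(1) show "wins S ?L (?turns m @ map a [Suc (length w) + m..<Suc (length w) + n]) v"
        by (simp del: upt_Suc)
      show "u \<in> ?L" if "u @ v \<in> ?L" for u v
        using that language_sublist by blast
    qed
    show ?thesis
    proof (cases "a (length w)")
      case PlayerA
      \<comment> \<open>Compactness: if each letter \<open>s\<close> failed at some horizon
        \<open>m s\<close>, all letters would fail at the maximum over the finite set
        \<open>S\<close>, whereas some letter wins there.\<close>
      have "\<exists>s\<in>S. \<forall>n. wins S ?L (?turns n) (w @ [s])"
      proof (rule ccontr)
        assume "\<not> ?thesis"
        then obtain m where m: "\<And>s. s \<in> S \<Longrightarrow> \<not> wins S ?L (?turns (m s)) (w @ [s])"
          by metis
        obtain s where "s \<in> S" "wins S ?L (?turns (Max (m ` S))) (w @ [s])"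
          using next_turn[of "Max (m ` S)"] PlayerA by auto
        moreover have "m s \<le> Max (m ` S)"
          using \<open>s \<in> S\<close> assms(1) by simp
        ultimately show False
          using m decreasing by blast
      qed
      with PlayerA show ?thesis
        by (simp add: G_def del: upt_Suc)
    next
      case PlayerB
      then show ?thesis
        using next_turn by (simp add: G_def del: upt_Suc)
    qed
  qed
  obtain \<sigma> where \<sigma>: "\<sigma> \<in> strategies S \<infinity>"
    and win: "\<And>\<tau> k. \<tau> \<in> strategies S \<infinity> \<Longrightarrow> G (play_prefix \<sigma> \<tau> a k)"
    using strategy_from_invariant[OF assms(2), of G \<infinity> a] \<open>G []\<close> step by auto
  have "infinite_play \<sigma> \<tau> a \<in> X" if \<tau>: "\<tau> \<in> strategies S \<infinity>" for \<tau>
  proof (rule subshift_memI[OF assms(3)])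
    let ?x = "infinite_play \<sigma> \<tau> a"
    show "range ?x \<subseteq> S"
    proof
      fix s assume "s \<in> range ?x"
      then obtain k where "s = ?x k" by blast
      then have "s \<in> set (play_prefix \<sigma> \<tau> a (Suc k))"
        unfolding infinite_play_def by (metis length_play_prefix lessI nth_mem)
      then show "s \<in> S"
        using play_prefix_in_lists[OF \<sigma> \<tau>, of "Suc k" a] by (auto simp del: play_prefix.simps)
    qed
    fix f assume "occurs_in f ?x"
    then obtain i where f: "factor_at ?x i (length f) = f"
      unfolding occurs_in_iff_factor_at by blast
    define n where "n = i + length f"
    have "sublist f (factor_at ?x 0 n)"
      using sublist_factor_at[of i "length f" n ?x 0] f by (simp add: n_def)
    \<comment> \<open>The case of horizon 0 in \<open>G\<close> says that the position itself lies
      in the language.\<close>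
    moreover have "factor_at ?x 0 n \<in> ?L"
      using win[OF \<tau>, of n] unfolding G_def
      by (simp add: factor_at_def infinite_play_prefix)
        (metis add.right_neutral list.map(1) upt_rec less_irrefl wins.simps(1))
    ultimately show "f \<in> ?L"
      by (rule language_sublist[rotated])
  qed
  with \<sigma> show "a \<in> infinite_winning_set S X"
    by (auto simp: infinite_winning_set_def)
qed

text \<open>Brings the one-sided winning shift into the form that defines the two-sided one. The
  game tests prefixes of \<open>a\<close>, the right-hand side all factors; a factor is a suffix of
  a prefix, so \<open>wins_suffix\<close> closes the gap.\<close>

lemma winning_shift_nat_eq_avoiding:
  assumes "finite S" "S \<noteq> {}" "subshift S X"
  shows "winning_shift_nat S X = avoiding UNIV (UNIV - winning_language S (language X))"
proof -
  have "(\<forall>n. wins S (language X) (map a [0..<n]) []) \<longleftrightarrow>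
    (\<forall>w. occurs_in w a \<longrightarrow> wins S (language X) w [])" (is "?prefixes \<longleftrightarrow> ?factors") for a
  proof
    assume ?prefixes
    show ?factors
    proof (intro allI impI)
      fix w assume "occurs_in w a"
      then obtain i where w: "factor_at a i (length w) = w"
        unfolding occurs_in_iff_factor_at by blast
      have "map a [0..<i + length w] = factor_at a 0 i @ w"
        using factor_at_add[of a 0 i "length w"] w by (simp add: factor_at_def)
      then have "wins S (language X) (factor_at a 0 i @ w) []"
        using \<open>?prefixes\<close> by metis
      then show "wins S (language X) w []"
        by (rule wins_suffix[OF assms(2), rotated]) (use language_sublist in blast)
    qed
  next
    assume ?factors
    then show ?prefixes
      using occurs_in_factor_at[of a 0] by (simp add: factor_at_def)
  qed
  with infinite_winning_set_iff[OF assms] have "a \<in> winning_shift_nat S X \<longleftrightarrow>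
    (\<forall>w. occurs_in w a \<longrightarrow> w \<in> winning_language S (language X))" for a
    by (simp add: winning_shift_nat_def winning_language_iff[OF assms(2)])
  then show ?thesis
    unfolding avoiding_def by blast
qed

text \<open>For \<open>z \<le> y\<close>, each factor of \<open>z\<close> lies letterwise below the
  factor of \<open>y\<close> at the same position, so \<open>wins_mono\<close> transfers the
  win.\<close>

lemma downward_closed_avoiding_winning_language:
  assumes "S \<noteq> {}"
  shows "downward_closed
    (avoiding UNIV (UNIV - winning_language S L) :: ('i::semiring_1 \<Rightarrow> player) set)"
proof -
  have "wins S L w []"
    if y: "\<forall>w. occurs_in w y \<longrightarrow> wins S L w []" and "z \<le> y" "occurs_in w z"
    for w and y z :: "'i \<Rightarrow> player"
  proof -
    obtain i where w: "factor_at z i (length w) = w"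
      using \<open>occurs_in w z\<close> unfolding occurs_in_iff_factor_at by blast
    have "list_all2 (\<le>) (factor_at z i (length w)) (factor_at y i (length w))"
      using \<open>z \<le> y\<close> by (simp add: factor_at_def list_all2_conv_all_nth le_fun_def)
    then have "list_all2 (\<le>) w (factor_at y i (length w))"
      by (simp add: w)
    then show ?thesis
      by (rule wins_mono[OF assms]) (simp add: y)
  qed
  moreover have "avoiding UNIV (UNIV - winning_language S L) =
      {y :: 'i \<Rightarrow> player. \<forall>w. occurs_in w y \<longrightarrow> wins S L w []}"
    by (auto simp: avoiding_def winning_language_iff[OF assms])
  ultimately show ?thesis
    unfolding downward_closed_def by simp
qed

section \<open>Downward closed subshifts as winning shifts over two letters\<close>

lemma language_downward_closed:
  fixes Y :: "('i::{semiring_char_0, semiring_1_cancel} \<Rightarrow> player) set"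
  assumes "downward_closed Y" "w \<in> language Y" "list_all2 (\<le>) v w"
  shows "v \<in> language Y"
proof -
  obtain y i where y: "y \<in> Y" and i: "\<And>k. k < length w \<Longrightarrow> y (i + of_nat k) = w ! k"
    using assms(2) by (auto simp: language_def occurs_in_def)
  \<comment> \<open>Overwrite \<open>y\<close> by \<open>v\<close> at the occurrence of
    \<open>w\<close>. The positions \<open>i + of_nat k\<close> are pairwise distinct by the type
    class assumptions, so \<open>THE k\<close> is well determined.\<close>
  define z where
    "z j = (if \<exists>k<length v. j = i + of_nat k then v ! (THE k. j = i + of_nat k) else y j)" for j
  have z: "z (i + of_nat k) = v ! k" if "k < length v" for k
    using that by (auto simp: z_def)
  have "z j \<le> y j" for j
  proof (cases "\<exists>k<length v. j = i + of_nat k")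
    case True
    then show ?thesis
      using z i assms(3) by (auto simp: list_all2_conv_all_nth)
  qed (auto simp: z_def)
  then have "z \<in> Y"
    using assms(1) y by (auto simp: downward_closed_def le_fun_def)
  moreover have "occurs_in v z"
    using z by (auto simp: occurs_in_def)
  ultimately show ?thesis
    by (auto simp: language_def)
qed

text \<open>For a downward closed \<open>M\<close>, the letter \<open>q\<close> is the harder one for \<open>A\<close>, so the optimal moves
  are \<open>p\<close> for \<open>A\<close> and \<open>q\<close> for \<open>B\<close>, and these reproduce the turn order itself.\<close>

lemma wins_two_letters:
  assumes "p \<noteq> q" and "\<And>u v. u \<in> M \<Longrightarrow> list_all2 (\<le>) v u \<Longrightarrow> v \<in> M"
  shows "wins {p, q} (map (case_player p q) ` M) a (map (case_player p q) u) \<longleftrightarrow> u @ a \<in> M"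
proof (induction a arbitrary: u)
  case Nil
  have "inj (case_player p q)"
    using assms(1) by (auto simp: inj_def split: player.splits)
  then have "inj (map (case_player p q))"
    by simp
  then show ?case
    by (simp add: inj_image_mem_iff)
next
  case (Cons t a)
  \<comment> \<open>Reduces each choice to one letter: at a turn of \<open>B\<close> only
    \<open>q\<close> has to be tested, and \<open>A\<close> may as well play
    \<open>p\<close>.\<close>
  have lower: "u @ PlayerA # a \<in> M" if "u @ PlayerB # a \<in> M"
    using that by (rule assms(2))
      (auto simp: list_all2_append list.rel_refl less_eq_player_def)
  show ?case
    using Cons.IH[of "u @ [PlayerA]"] Cons.IH[of "u @ [PlayerB]"] lower by (cases t) auto
qed

text \<open>\<open>X\<close> is a copy of \<open>Y\<close> on letters from \<open>'s\<close>. By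
  \<open>wins_two_letters\<close> the winning language of the copy is \<open>language Y\<close>,
  which determines the subshift \<open>Y\<close>.\<close>

lemma ex_two_letter_subshift:
  fixes Y :: "('i::{semiring_char_0, semiring_1_cancel} \<Rightarrow> player) set" and p q :: 's
  assumes "subshift UNIV Y" "downward_closed Y" "p \<noteq> q"
  shows "\<exists>X :: ('i \<Rightarrow> 's) set. subshift {p, q} X \<and>
    avoiding UNIV (UNIV - winning_language {p, q} (language X)) = Y"
proof -
  define \<phi> where "\<phi> = case_player p q"
  define X where "X = (\<lambda>y. \<phi> \<circ> y) ` Y"
  have inj: "inj \<phi>"
    using assms(3) by (auto simp: \<phi>_def inj_def split: player.splits)
  have range: "range \<phi> = {p, q}"
    unfolding \<phi>_def by (auto split: player.splits)
  have occurs: "occurs_in (map \<phi> w) (\<phi> \<circ> y) \<longleftrightarrow> occurs_in w y" for w and y :: "'i \<Rightarrow> player"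
    using inj by (simp add: occurs_in_def inj_eq)
  obtain F where Y: "Y = avoiding UNIV F"
    using assms(1) by (auto simp: subshift_def)
  have "X = avoiding {p, q} (map \<phi> ` F)"
  proof
    show "X \<subseteq> avoiding {p, q} (map \<phi> ` F)"
      using range by (auto simp: X_def Y avoiding_def occurs)
    show "avoiding {p, q} (map \<phi> ` F) \<subseteq> X"
    proof
      fix x :: "'i \<Rightarrow> 's" assume x: "x \<in> avoiding {p, q} (map \<phi> ` F)"
      then have "range x \<subseteq> range \<phi>"
        using range by (simp add: avoiding_def)
      \<comment> \<open>Every point over \<open>{p, q}\<close> is a renamed turn order, as
        \<open>\<phi>\<close> reaches both letters.\<close>
      then have "x = \<phi> \<circ> (inv \<phi> \<circ> x)"
        by (simp add: fun_eq_iff f_inv_into_f image_subset_iff)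
      then obtain y where "x = \<phi> \<circ> y" ..
      with x show "x \<in> X"
        by (auto simp: X_def Y avoiding_def occurs)
    qed
  qed
  moreover have "map \<phi> ` F \<subseteq> lists {p, q}"
    by (auto simp flip: range)
  ultimately have "subshift {p, q} X"
    by (simp add: subshift_avoiding)
  have "language X = map \<phi> ` language Y"
  proof
    show "map \<phi> ` language Y \<subseteq> language X"
      using occurs by (auto simp: language_def X_def)
    show "language X \<subseteq> map \<phi> ` language Y"
    proof
      fix w assume "w \<in> language X"
      then obtain y i where y: "y \<in> Y" and w: "factor_at (\<phi> \<circ> y) i (length w) = w"
        by (auto simp: language_def X_def occurs_in_iff_factor_at)
      have "w = map \<phi> (factor_at y i (length w))"
        by (subst w[symmetric]) (simp add: factor_at_def)
      moreover have "factor_at y i (length w) \<in> language Y"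
        using y by (rule factor_at_in_language)
      ultimately show "w \<in> map \<phi> ` language Y"
        by blast
    qed
  qed
  moreover have "wins {p, q} (map \<phi> ` language Y) a [] \<longleftrightarrow> a \<in> language Y" for a
    using wins_two_letters[OF assms(3) language_downward_closed[OF assms(2)], where u = "[]"]
    by (simp add: \<phi>_def)
  ultimately have "winning_language {p, q} (language X) = language Y"
    by (intro set_eqI) (simp add: winning_language_iff)
  with avoiding_Compl_language[OF assms(1)] \<open>subshift {p, q} X\<close> show ?thesis
    by auto
qed

text \<open>Treats both index sets at once: \<open>W\<close> stands for either winning shift
  operator. Its formula is the definition over the integers and
  \<open>winning_shift_nat_eq_avoiding\<close> over the natural numbers.\<close>

lemma winning_shift_class_eq:
  fixes \<W> :: "(('i::{semiring_char_0, semiring_1_cancel}) \<Rightarrow> player) set set"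
  assumes "infinite (UNIV :: 's set)"
    and \<W>: "\<W> = {W S X | (S :: 's set) (X :: ('i \<Rightarrow> 's) set).
      finite S \<and> S \<noteq> {} \<and> subshift S X}"
    and W: "\<And>S X. finite S \<Longrightarrow> S \<noteq> {} \<Longrightarrow> subshift S X \<Longrightarrow>
      W S X = avoiding UNIV (UNIV - winning_language S (language X))"
  shows "\<W> = {Y. subshift UNIV Y \<and> downward_closed Y}"
proof
  show "\<W> \<subseteq> {Y. subshift UNIV Y \<and> downward_closed Y}"
  proof
    fix Y assume "Y \<in> \<W>"
    then obtain S X where "finite S" "S \<noteq> {}" "subshift S X" "Y = W S X"
      unfolding \<W> by blast
    then show "Y \<in> {Y. subshift UNIV Y \<and> downward_closed Y}"
      by (simp add: W subshift_avoiding downward_closed_avoiding_winning_language)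
  qed
  obtain p q :: 's where pq: "p \<noteq> q"
    using assms(1) by (metis ex_new_if_finite finite.emptyI finite_insert insertI1)
  show "{Y. subshift UNIV Y \<and> downward_closed Y} \<subseteq> \<W>"
  proof safe
    fix Y :: "('i \<Rightarrow> player) set"
    assume "subshift UNIV Y" "downward_closed Y"
    then obtain X :: "('i \<Rightarrow> 's) set" where "subshift {p, q} X"
      "avoiding UNIV (UNIV - winning_language {p, q} (language X)) = Y"
      using ex_two_letter_subshift[OF _ _ pq] by blast
    then have "Y = W {p, q} X"
      using W by auto
    with \<open>subshift {p, q} X\<close> show "Y \<in> \<W>"
      unfolding \<W> by blast
  qed
qed

section \<open>Closure of the class under union and intersection\<close>

lemma downward_closed_Un: "downward_closed Y \<Longrightarrow> downward_closed Z \<Longrightarrow> downward_closed (Y \<union> Z)"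
  unfolding downward_closed_def by blast

lemma downward_closed_Int: "downward_closed Y \<Longrightarrow> downward_closed Z \<Longrightarrow> downward_closed (Y \<inter> Z)"
  unfolding downward_closed_def by blast

theorem corollary3p14:
  assumes "infinite (UNIV :: 's set)"
  shows "winning_shifts_nat TYPE('s) = {Y. subshift UNIV Y \<and> downward_closed Y}
    \<and> (\<forall>Y \<in> winning_shifts_nat TYPE('s). \<forall>Z \<in> winning_shifts_nat TYPE('s).
          Y \<union> Z \<in> winning_shifts_nat TYPE('s) \<and> Y \<inter> Z \<in> winning_shifts_nat TYPE('s))
    \<and> winning_shifts_int TYPE('s) = {Y. subshift UNIV Y \<and> downward_closed Y}
    \<and> (\<forall>Y \<in> winning_shifts_int TYPE('s). \<forall>Z \<in> winning_shifts_int TYPE('s).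
          Y \<union> Z \<in> winning_shifts_int TYPE('s) \<and> Y \<inter> Z \<in> winning_shifts_int TYPE('s))"
proof -
  have nat: "winning_shifts_nat TYPE('s) = {Y. subshift UNIV Y \<and> downward_closed Y}"
    by (rule winning_shift_class_eq[OF assms winning_shifts_nat_def winning_shift_nat_eq_avoiding])
  have int: "winning_shifts_int TYPE('s) = {Y. subshift UNIV Y \<and> downward_closed Y}"
    by (rule winning_shift_class_eq[OF assms winning_shifts_int_def winning_shift_int_def])
  \<comment> \<open>For \<open>subshift_Un\<close>: of two positions, one is reached from the other
    by a nonnegative shift.\<close>
  have comparable_nat: "(\<exists>d. j = i + of_nat d) \<or> (\<exists>d. i = j + of_nat d)" for i j :: nat
    by (metis le_Suc_ex nat_le_linear of_nat_id)
  have comparable_int: "(\<exists>d. j = i + of_nat d) \<or> (\<exists>d. i = j + of_nat d)" for i j :: int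
    by (metis linear zle_iff_zadd)
  show ?thesis
    unfolding nat int
    using subshift_Un[OF _ _ comparable_nat] subshift_Un[OF _ _ comparable_int]
    by (auto intro: subshift_Int downward_closed_Un downward_closed_Int)
qed

end
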